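(* Suppose that $\sigma_k^m\in\mathcal W_0$, or equivalently $\alpha_{k,m}\ne0$, for all $k\in\{\hat e_1,\hat e_2,\hat e_3\}$ and $m\in\{0,1\}$. Then the H\"ormander bracket condition holds: for every $N>0$ there exists $n=n(N)$ such that $\mathcal W_n\supseteq H_N$.
   Context: Functions live on $\mathbb T^3=\mathbb R^3/(2\pi\mathbb Z)^3$. $\nu>0$ is fixed; $\hat e_1,\hat e_2,\hat e_3$ is the standard basis; $\hat\Omega=\cos\lambda\,\hat e_3-\sin\lambda\,\hat e_2$ for a fixed angle $\lambda$; $\hat B_0$ is a fixed constant unit vector in $\mathbb R^3$. $\mathbb Z^3_+=\{k\in\mathbb Z^3:k\ne0,\ k_1\ge0\}$, $\sigma_k^0(x)=\cos(k\cdot x)$, $\sigma_k^1(x)=\sin(k\cdot x)$. The real numbers $\alpha_{k,m}$ ($k\in\mathbb Z^3_+$, $m\in\{0,1\}$) are noise amplitudes. $M_u$ is the Fourier multiplier mapping mean-zero scalar functions to divergence-free vector fields with symbol, for $k\in\mathbb Z^3\setminus\{0\}$, $$\mathcal M_u(k)=\frac{(\nu|k|^4+(\hat B_0\cdot k)^2)\,(k\times(\hat e_3\times k))+(\hat\Omega\cdot k)|k|^2(\hat e_3\times k)}{|k|^2(\hat\Omega\cdot k)^2+((\hat B_0\cdot k)^2+\nu|k|^4)^2};$$ in particular $M_u(\sigma_k^m)=\mathcal M_u(k)\sigma_k^m$. Bracket spaces: $\mathcal W_0=\mathrm{span}\{\sigma_j^m:\alpha_{j,m}\ne0\}$ and,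 for $n\ge1$, $\mathcal W_n=\mathrm{span}\big(\{M_u(\psi)\cdot\nabla\varsigma+M_u(\varsigma)\cdot\nabla\psi:\psi\in\mathcal W_{n-1},\varsigma\in\mathcal W_0\}\cup\mathcal W_{n-1}\big)$. $H_N=\mathrm{span}\{\sigma_k^m:k\in\mathbb Z^3_+,|k|\le N,m\in\{0,1\}\}$. *)

theory Defs
  imports "HOL-Analysis.Analysis" "HOL-Library.Function_Algebras"
begin

text \<open>
  Functions on the torus \<open>\<real>\<^sup>3 / (2\<pi>\<int>)\<^sup>3\<close> are represented by functions on \<open>real ^ 3\<close>; all elements of the
  spaces below are \<open>2\<pi>\<close>-periodic in each coordinate. Wave vectors are elements of \<open>real ^ 3\<close>
  with integer coordinates.
\<close>

definition int_lattice :: "(real ^ 3) set" where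
  "int_lattice = {k. \<forall>i. k $ i \<in> \<int>}"

definition int_lattice_plus :: "(real ^ 3) set" where
  "int_lattice_plus = {k \<in> int_lattice. k \<noteq> 0 \<and> k $ 1 \<ge> 0}"

abbreviation e_hat :: "3 \<Rightarrow> real ^ 3" where
  "e_hat i \<equiv> axis i 1"

definition Omega_hat :: "real \<Rightarrow> real ^ 3" where
  "Omega_hat lam = cos lam *\<^sub>R e_hat 3 - sin lam *\<^sub>R e_hat 2"

definition sigma_mode :: "real ^ 3 \<Rightarrow> nat \<Rightarrow> (real ^ 3 \<Rightarrow> real)" where
  "sigma_mode k m = (\<lambda>x. if m = 0 then cos (k \<bullet> x) else sin (k \<bullet> x))"

definition Mu_symbol :: "real \<Rightarrow> real \<Rightarrow> real ^ 3 \<Rightarrow> real ^ 3 \<Rightarrow> real ^ 3" where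
  "Mu_symbol \<nu> lam B0 k =
     (1 / (norm k ^ 2 * (Omega_hat lam \<bullet> k) ^ 2 + ((B0 \<bullet> k) ^ 2 + \<nu> * norm k ^ 4) ^ 2)) *\<^sub>R
       ((\<nu> * norm k ^ 4 + (B0 \<bullet> k) ^ 2) *\<^sub>R cross3 k (cross3 (e_hat 3) k)
        + ((Omega_hat lam \<bullet> k) * norm k ^ 2) *\<^sub>R cross3 (e_hat 3) k)"

definition fourier_coeff :: "(real ^ 3 \<Rightarrow> real) \<Rightarrow> real ^ 3 \<Rightarrow> complex" where
  "fourier_coeff f k =
     (LINT x : cbox 0 (\<chi> i. 2 * pi) | lborel. complex_of_real (f x) * cis (- (k \<bullet> x)))
       / complex_of_real ((2 * pi) ^ 3)"

text \<open>
  The Fourier multiplier. The symbol is real and even and \<open>f\<close> is real-valued, so the terms for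
  \<open>k\<close> and \<open>-k\<close> are complex conjugate and the series may be summed by real parts. The series is an
  unconditional pointwise sum; on trigonometric polynomials it has only finitely many nonzero terms.
\<close>
definition Mu :: "real \<Rightarrow> real \<Rightarrow> real ^ 3 \<Rightarrow> (real ^ 3 \<Rightarrow> real) \<Rightarrow> (real ^ 3 \<Rightarrow> real ^ 3)" where
  "Mu \<nu> lam B0 f = (\<lambda>x. \<Sum>\<^sub>\<infinity>k \<in> int_lattice - {0}.
     Re (fourier_coeff f k * cis (k \<bullet> x)) *\<^sub>R Mu_symbol \<nu> lam B0 k)"

definition grad :: "(real ^ 3 \<Rightarrow> real) \<Rightarrow> (real ^ 3 \<Rightarrow> real ^ 3)" where
  "grad f = (\<lambda>x. \<chi> i. frechet_derivative f (at x) (e_hat i))"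

definition bracket ::
  "real \<Rightarrow> real \<Rightarrow> real ^ 3 \<Rightarrow> (real ^ 3 \<Rightarrow> real) \<Rightarrow> (real ^ 3 \<Rightarrow> real) \<Rightarrow> (real ^ 3 \<Rightarrow> real)" where
  "bracket \<nu> lam B0 \<psi> \<phi> = (\<lambda>x. Mu \<nu> lam B0 \<psi> x \<bullet> grad \<phi> x + Mu \<nu> lam B0 \<phi> x \<bullet> grad \<psi> x)"

text \<open>The function space carries no \<open>real_vector\<close> instance, so its linear span is obtained from
  the locale \<open>vector_space\<close> with pointwise scaling.\<close>

definition fun_scale :: "real \<Rightarrow> (real ^ 3 \<Rightarrow> real) \<Rightarrow> (real ^ 3 \<Rightarrow> real)" where
  "fun_scale c f = (\<lambda>x. c * f x)"

interpretation fun_space: vector_space fun_scale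
  by unfold_locales (auto simp: fun_scale_def fun_eq_iff algebra_simps)

definition W_zero :: "(real ^ 3 \<Rightarrow> nat \<Rightarrow> real) \<Rightarrow> (real ^ 3 \<Rightarrow> real) set" where
  "W_zero \<alpha> = fun_space.span {sigma_mode j m | j m. j \<in> int_lattice_plus \<and> m \<in> {0, 1} \<and> \<alpha> j m \<noteq> 0}"

primrec W_space ::
  "real \<Rightarrow> real \<Rightarrow> real ^ 3 \<Rightarrow> (real ^ 3 \<Rightarrow> nat \<Rightarrow> real) \<Rightarrow> nat \<Rightarrow> (real ^ 3 \<Rightarrow> real) set" where
  "W_space \<nu> lam B0 \<alpha> 0 = W_zero \<alpha>"
| "W_space \<nu> lam B0 \<alpha> (Suc n) = fun_space.span
     ({bracket \<nu> lam B0 \<psi> \<phi> | \<psi> \<phi>. \<psi> \<in> W_space \<nu> lam B0 \<alpha> n \<and> \<phi> \<in> W_zero \<alpha>}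
      \<union> W_space \<nu> lam B0 \<alpha> n)"

definition H_space :: "real \<Rightarrow> (real ^ 3 \<Rightarrow> real) set" where
  "H_space N = fun_space.span {sigma_mode k m | k m. k \<in> int_lattice_plus \<and> norm k \<le> N \<and> m \<in> {0, 1}}"

text \<open>Since \<open>int_lattice_plus\<close> contains both \<open>k\<close> and \<open>-k\<close> when \<open>k $ 1 = 0\<close>, and these carry the same
  modes up to sign, the converse of the next lemma can fail for such \<open>k\<close>.\<close>

lemma sigma_in_W_zero:
  assumes "k \<in> int_lattice_plus" and "m \<in> {0, 1}" and "\<alpha> k m \<noteq> 0"
  shows "sigma_mode k m \<in> W_zero \<alpha>"
  unfolding W_zero_def using assms by (intro fun_space.span_base) blast

end

theory Submission
  imports Defs
begin

text \<open>
  Why every frequency is generated. Write \<open>M k\<close> for the symbol of the multiplier at \<open>k\<close>. For plane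
  waves, the multiplier is multiplication by \<open>M k\<close> and the gradient is a phase shift times \<open>k\<close>, so
  brackets of waves at \<open>k\<close> and \<open>l\<close> are combinations of waves at \<open>k + l\<close> and \<open>k - l\<close>. Combining two
  brackets with shifted phases leaves only \<open>k + l\<close>, with coefficient \<open>M k \<bullet> l + M l \<bullet> k\<close>
  (\<open>bracket_plane_wave_sum\<close>). The question becomes which lattice vectors can be reached from the forced
  ones by adding vectors \<open>l\<close> of the form \<open>e_hat i\<close> or \<open>- e_hat i\<close> along steps with nonzero coefficient
  (\<open>reachable_step\<close>).

  The explicit form of \<open>M\<close> enters only through five properties: it is even; \<open>M k \<bullet> k = 0\<close>;
  \<open>M (e_hat 3) = 0\<close>; \<open>M k \<bullet> e_hat 3 > 0\<close> for \<open>k\<close> off the vertical axis; and \<open>|M k| \<le> 2 / \<nu>\<close> for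
  \<open>|k| \<ge> 1\<close>. By the third and fourth, vertical steps never degenerate off the axis
  (\<open>reachable_vertical\<close>). A horizontal step may degenerate, but not at large height: \<open>M k \<bullet> l\<close> is
  bounded while \<open>M l \<bullet> k\<close> grows linearly with the height of \<open>k\<close>. Climbing, stepping sideways and
  descending realises every horizontal step between vertical lines other than the axis
  (\<open>reachable_horizontal\<close>). This covers all lattice vectors off the axis. The axis itself is entered
  from \<open>e_hat 1 + n e_hat 3\<close>, where \<open>M k \<bullet> k = 0\<close> turns the coefficient into \<open>n\<close> times a sum of two
  positive numbers (\<open>reachable_axis\<close>). Finally, a ball contains finitely many lattice vectors and the
  bracket spaces increase, so a single level suffices (\<open>H_space_subset_W\<close>).
\<close>

section \<open>Orthogonality of Fourier modes\<close>

lemma lborel_integral_prod_coordinates: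
  fixes f :: "'a::euclidean_space \<Rightarrow> real \<Rightarrow> complex"
  assumes "\<And>b. b \<in> Basis \<Longrightarrow> integrable lborel (f b)"
  shows "(LINT x|lborel. (\<Prod>b\<in>Basis. f b (x \<bullet> b))) = (\<Prod>b\<in>Basis. LINT t|lborel. f b t)"
proof -
  interpret product_sigma_finite "\<lambda>_::'a. lborel :: real measure"
    by unfold_locales
  have [measurable]: "f b \<in> borel_measurable borel" if "b \<in> Basis" for b
    using borel_measurable_integrable[OF assms[OF that]] by simp
  have "(LINT x|lborel. (\<Prod>b\<in>Basis. f b (x \<bullet> b)))
      = (LINT y|(\<Pi>\<^sub>M b\<in>Basis. lborel). (\<Prod>b\<in>Basis. f b ((\<Sum>b\<in>Basis. y b *\<^sub>R b) \<bullet> b)))"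
    by (subst lborel_eq, subst integral_distr) simp_all
  also have "\<dots> = (LINT y|(\<Pi>\<^sub>M b\<in>Basis. lborel). (\<Prod>b\<in>(Basis::'a set). f b (y b)))"
    by (simp cong: prod.cong)
  also have "\<dots> = (\<Prod>b\<in>Basis. LINT t|lborel. f b t)"
    by (rule product_integral_prod) (simp_all add: assms)
  finally show ?thesis .
qed

lemma integral_cis_over_period:
  fixes n :: real
  assumes "n \<in> \<int>"
  shows "has_bochner_integral lborel (\<lambda>t. indicator {0..2 * pi} t *\<^sub>R cis (n * t))
           (if n = 0 then of_real (2 * pi) else 0)"
proof (cases "n = 0")
  case True
  have "has_bochner_integral lborel (\<lambda>t. indicator {0..2 * pi} t *\<^sub>R (1::complex))
      (of_real (2 * pi) - of_real 0)"
    by (rule has_bochner_integral_FTC_Icc) (auto intro!: derivative_eq_intros)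
  with True show ?thesis by simp
next
  case False
  have "cis (n * (2 * pi)) = 1"
    using assms by (metis cis_multiple_2pi mult.commute)
  moreover have "has_bochner_integral lborel (\<lambda>t. indicator {0..2 * pi} t *\<^sub>R cis (n * t))
      (cis (n * (2 * pi)) / (\<i> * n) - cis (n * 0) / (\<i> * n))"
  proof (rule has_bochner_integral_FTC_Icc)
    fix t :: real
    have "((\<lambda>t. cis (n * t)) has_vector_derivative n *\<^sub>R (\<i> * cis (n * t))) (at t within {0..2 * pi})"
      unfolding has_vector_derivative_def
      by (auto intro!: derivative_eq_intros simp: fun_eq_iff scaleR_conv_of_real)
    from has_vector_derivative_divide[OF this, of "\<i> * n"]
    show "((\<lambda>t. cis (n * t) / (\<i> * n)) has_vector_derivative cis (n * t)) (at t within {0..2 * pi})"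
      using False by (simp add: scaleR_conv_of_real)
  qed (auto intro!: continuous_intros)
  ultimately show ?thesis
    using False by simp
qed

lemma cis_inner:
  "cis (k \<bullet> x) = (\<Prod>b\<in>Basis. cis ((k \<bullet> b) * (x \<bullet> b)))" for k x :: "'a::euclidean_space"
  by (subst euclidean_inner)
    (simp add: cis_conv_exp sum_distrib_left exp_sum)

text \<open>
  The box is a product and \<open>cis (k \<bullet> x)\<close> factors over the coordinates, so Fubini reduces the
  integral to one-dimensional periods; one of them vanishes as soon as some coordinate of \<open>k\<close> does
  not. Applied to differences of wave vectors, this is the orthogonality of the Fourier modes.
\<close>

lemma integral_cis_over_box:
  assumes "k \<in> int_lattice"
  shows "has_bochner_integral lborel (\<lambda>x. indicator (cbox 0 (\<chi> i. 2 * pi)) x *\<^sub>R cis (k \<bullet> x))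
           (if k = 0 then complex_of_real ((2 * pi) ^ 3) else 0)"
proof -
  let ?f = "\<lambda>b t. indicator {0..2 * pi} t *\<^sub>R cis ((k \<bullet> b) * t)"
  have k: "k \<bullet> b \<in> \<int>" if "b \<in> Basis" for b
    using assms that by (auto simp: int_lattice_def Basis_vec_def inner_axis)
  have eq: "indicator (cbox 0 (\<chi> i. 2 * pi)) x *\<^sub>R cis (k \<bullet> x) = (\<Prod>b\<in>Basis. ?f b (x \<bullet> b))" for x
  proof (cases "x \<in> cbox 0 (\<chi> i. 2 * pi)")
    case True
    then have "indicator {0..2 * pi} (x \<bullet> b) = (1::real)" if "b \<in> Basis" for b
      using that by (auto simp: Basis_vec_def inner_axis mem_box_cart)
    then show ?thesis
      using True by (subst cis_inner) (simp cong: prod.cong)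
  next
    case False
    then obtain i where "\<not> (0 \<le> x $ i \<and> x $ i \<le> 2 * pi)"
      by (auto simp: mem_box_cart)
    then have "?f (axis i 1) (x \<bullet> axis i 1) = 0"
      by (auto simp: inner_axis)
    moreover have "axis i 1 \<in> (Basis :: (real ^ 3) set)"
      by (auto simp: Basis_vec_def)
    ultimately have "(\<Prod>b\<in>Basis. ?f b (x \<bullet> b)) = 0"
      by (intro prod_zero bexI[of _ "axis i 1"] finite_Basis)
    then show ?thesis
      using False by simp
  qed
  have "(LINT x|lborel. indicator (cbox 0 (\<chi> i. 2 * pi)) x *\<^sub>R cis (k \<bullet> x)) = (\<Prod>b\<in>Basis. LINT t|lborel. ?f b t)"
    unfolding eq using integral_cis_over_period[OF k]
    by (intro lborel_integral_prod_coordinates) (auto simp: has_bochner_integral_iff)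
  also have "\<dots> = (\<Prod>b\<in>Basis. if k \<bullet> b = 0 then of_real (2 * pi) else 0)"
    using integral_cis_over_period[OF k]
    by (intro prod.cong) (auto simp: has_bochner_integral_iff)
  also have "\<dots> = (if k = 0 then complex_of_real ((2 * pi) ^ 3) else 0)"
  proof (cases "k = 0")
    case False
    then obtain b where "b \<in> Basis" "k \<bullet> b \<noteq> 0"
      using euclidean_eq_iff[of k 0] by auto
    then show ?thesis
      using False by (auto intro!: prod_zero bexI[of _ b])
  qed simp
  finally have "(LINT x|lborel. indicator (cbox 0 (\<chi> i. 2 * pi)) x *\<^sub>R cis (k \<bullet> x)) = (if k = 0 then complex_of_real ((2 * pi) ^ 3) else 0)" .
  moreover have "integrable lborel (\<lambda>x. indicator (cbox 0 (\<chi> i. 2 * pi)) x *\<^sub>R cis (k \<bullet> x))"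
    by (intro borel_integrable_compact) (auto intro!: continuous_intros)
  ultimately show ?thesis
    by (simp add: has_bochner_integral_iff)
qed

section \<open>Plane waves and their Fourier coefficients\<close>

text \<open>
  One complex amplitude encodes both \<open>sigma_mode k 0\<close> and \<open>sigma_mode k 1\<close>. The product of two
  waves is then a sum of two waves, and the signs of the trigonometric addition theorems are
  carried by multiplication with \<open>\<i>\<close>.
\<close>

definition plane_wave :: "complex \<Rightarrow> real ^ 3 \<Rightarrow> real ^ 3 \<Rightarrow> real" where
  "plane_wave c k = (\<lambda>x. Re (c * cis (k \<bullet> x)))"

lemma int_lattice_add: "k \<in> int_lattice \<Longrightarrow> l \<in> int_lattice \<Longrightarrow> k + l \<in> int_lattice"
  by (simp add: int_lattice_def)

lemma int_lattice_uminus: "k \<in> int_lattice \<Longrightarrow> - k \<in> int_lattice"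
  by (simp add: int_lattice_def)

text \<open>
  Being real, the wave splits into \<open>(c cis (k \<bullet> x) + cnj c cis (- k \<bullet> x)) / 2\<close>. The two conditions
  overlap only for \<open>k = 0\<close>, where both halves contribute to the mean.
\<close>

lemma fourier_coeff_plane_wave:
  assumes "k \<in> int_lattice" "j \<in> int_lattice"
  shows "fourier_coeff (plane_wave c k) j = ((if j = k then c else 0) + (if j = - k then cnj c else 0)) / 2"
proof -
  let ?I = "\<lambda>x. indicator (cbox 0 (\<chi> i. 2 * pi)) x :: real"
  let ?E = "\<lambda>q. if q = 0 then complex_of_real ((2 * pi) ^ 3) else 0"
  have "k - j \<in> int_lattice" "- k - j \<in> int_lattice"
    using assms int_lattice_add int_lattice_uminus by (metis diff_conv_add_uminus)+
  from has_bochner_integral_mult_right[OF integral_cis_over_box[OF this(1)], of "c / 2"]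
       has_bochner_integral_mult_right[OF integral_cis_over_box[OF this(2)], of "cnj c / 2"]
  have "has_bochner_integral lborel (\<lambda>x. c / 2 * (?I x *\<^sub>R cis ((k - j) \<bullet> x)) + cnj c / 2 * (?I x *\<^sub>R cis ((- k - j) \<bullet> x)))
     (c / 2 * ?E (k - j) + cnj c / 2 * ?E (- k - j))"
    by (intro has_bochner_integral_add) auto
  moreover have "c / 2 * (?I x *\<^sub>R cis ((k - j) \<bullet> x)) + cnj c / 2 * (?I x *\<^sub>R cis ((- k - j) \<bullet> x))
      = ?I x *\<^sub>R (complex_of_real (plane_wave c k x) * cis (- (j \<bullet> x)))" for x
  proof -
    have "complex_of_real (Re (c * cis (k \<bullet> x))) = (c * cis (k \<bullet> x) + cnj c * cis (- (k \<bullet> x))) / 2"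
      using complex_add_cnj[of "c * cis (k \<bullet> x)"] by (simp add: cis_cnj)
    moreover have "cis ((k - j) \<bullet> x) = cis (k \<bullet> x) * cis (- (j \<bullet> x))"
        "cis ((- k - j) \<bullet> x) = cis (- (k \<bullet> x)) * cis (- (j \<bullet> x))"
      by (simp_all add: cis_mult inner_diff_left)
    ultimately show ?thesis
      by (simp add: plane_wave_def scaleR_conv_of_real algebra_simps add_divide_distrib)
  qed
  ultimately have "(LINT x : cbox 0 (\<chi> i. 2 * pi) | lborel. complex_of_real (plane_wave c k x) * cis (- (j \<bullet> x)))
     = c / 2 * ?E (k - j) + cnj c / 2 * ?E (- k - j)"
    by (simp add: has_bochner_integral_iff set_lebesgue_integral_def)
  moreover have "k - j = 0 \<longleftrightarrow> j = k" "- k - j = 0 \<longleftrightarrow> j = - k"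
    by auto
  ultimately show ?thesis
    by (auto simp: fourier_coeff_def field_simps)
qed

section \<open>The bracket of two plane waves\<close>

lemma plane_wave_uminus: "plane_wave c (- k) = plane_wave (cnj c) k"
  by (simp add: plane_wave_def fun_eq_iff)

lemma plane_wave_eq_modes:
  "plane_wave c k = fun_scale (Re c) (sigma_mode k 0) + fun_scale (- Im c) (sigma_mode k 1)"
  by (simp add: plane_wave_def sigma_mode_def fun_scale_def fun_eq_iff)

lemma sigma_mode_eq_plane_wave: "sigma_mode k m = plane_wave (if m = 0 then 1 else - \<i>) k"
  by (simp add: plane_wave_def sigma_mode_def fun_eq_iff)

lemma grad_plane_wave: "grad (plane_wave c k) x = plane_wave (\<i> * c) k x *\<^sub>R k"
proof -
  have "(plane_wave c k has_derivative (\<lambda>h. plane_wave (\<i> * c) k x * (k \<bullet> h))) (at x)"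
    unfolding plane_wave_def
    by (auto intro!: derivative_eq_intros simp: fun_eq_iff algebra_simps)
  then have "frechet_derivative (plane_wave c k) (at x) = (\<lambda>h. plane_wave (\<i> * c) k x * (k \<bullet> h))"
    by (rule frechet_derivative_at [symmetric])
  then show ?thesis
    by (simp add: grad_def vec_eq_iff inner_axis)
qed

lemma Mu_symbol_uminus: "Mu_symbol \<nu> lam B0 (- k) = Mu_symbol \<nu> lam B0 k"
  by (simp add: Mu_symbol_def)

text \<open>
  Only the frequencies \<open>k\<close> and \<open>- k\<close> occur. They carry conjugate coefficients and the same symbol,
  so that their two contributions add up to the original wave times the symbol.
\<close>

lemma Mu_plane_wave:
  assumes "k \<in> int_lattice" "k \<noteq> 0"
  shows "Mu \<nu> lam B0 (plane_wave c k) x = plane_wave c k x *\<^sub>R Mu_symbol \<nu> lam B0 k"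
proof -
  let ?f = "\<lambda>j. Re (fourier_coeff (plane_wave c k) j * cis (j \<bullet> x)) *\<^sub>R Mu_symbol \<nu> lam B0 j"
  have "k \<noteq> - k"
    using assms(2) by (auto simp: vec_eq_iff)
  have "Mu \<nu> lam B0 (plane_wave c k) x = infsum ?f {k, - k}"
    unfolding Mu_def using assms int_lattice_uminus
    by (intro infsum_cong_neutral) (auto simp: fourier_coeff_plane_wave)
  also have "\<dots> = ?f k + ?f (- k)"
    using \<open>k \<noteq> - k\<close> by simp
  also have "\<dots> = (Re (c / 2 * cis (k \<bullet> x)) + Re (cnj c / 2 * cis (- (k \<bullet> x)))) *\<^sub>R Mu_symbol \<nu> lam B0 k"
    using assms \<open>k \<noteq> - k\<close> int_lattice_uminus[OF assms(1)]
    by (simp add: fourier_coeff_plane_wave Mu_symbol_uminus flip: scaleR_add_left)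
  also have "Re (c / 2 * cis (k \<bullet> x)) + Re (cnj c / 2 * cis (- (k \<bullet> x))) = plane_wave c k x"
    by (simp add: plane_wave_def)
  finally show ?thesis .
qed

text \<open>
  A single bracket of waves at \<open>k\<close> and \<open>l\<close> mixes the frequencies \<open>k + l\<close> and \<open>k - l\<close>. Shifting the
  phase by \<open>- \<i>\<close> in the first factor and by \<open>\<i>\<close> in the second leaves the contribution at \<open>k + l\<close>
  unchanged, where the amplitudes are multiplied, and reverses the sign at \<open>k - l\<close>, where the second
  amplitude is conjugated. The sum of the two brackets therefore isolates \<open>k + l\<close>.
\<close>

lemma bracket_plane_wave_sum:
  assumes "k \<in> int_lattice" "k \<noteq> 0" "l \<in> int_lattice" "l \<noteq> 0"
  shows "bracket \<nu> lam B0 (plane_wave c k) (plane_wave 1 l) + bracket \<nu> lam B0 (plane_wave (- \<i> * c) k) (plane_wave \<i> l)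
    = fun_scale (Mu_symbol \<nu> lam B0 k \<bullet> l + Mu_symbol \<nu> lam B0 l \<bullet> k) (plane_wave (\<i> * c) (k + l))"
proof
  fix x
  show "(bracket \<nu> lam B0 (plane_wave c k) (plane_wave 1 l) + bracket \<nu> lam B0 (plane_wave (- \<i> * c) k) (plane_wave \<i> l)) x
    = fun_scale (Mu_symbol \<nu> lam B0 k \<bullet> l + Mu_symbol \<nu> lam B0 l \<bullet> k) (plane_wave (\<i> * c) (k + l)) x"
    using assms
    by (simp add: bracket_def Mu_plane_wave grad_plane_wave fun_scale_def)
      (simp add: plane_wave_def cos_add sin_add algebra_simps)
qed

section \<open>Size and direction of the symbol\<close>

lemma norm_cross3_le: "norm (cross3 x y) \<le> norm x * norm y"
proof -
  have "(norm (cross3 x y))\<^sup>2 \<le> (norm x * norm y)\<^sup>2"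
    using norm_cross_dot[of x y] zero_le_power2[of "x \<bullet> y"] by linarith
  then show ?thesis
    by (rule power2_le_imp_le) simp
qed

text \<open>
  The velocity fields \<open>Mu\<close> produces are divergence-free; on the Fourier side this is orthogonality
  to the wave vector.
\<close>

lemma Mu_symbol_inner_self: "Mu_symbol \<nu> lam B0 k \<bullet> k = 0"
  by (simp add: Mu_symbol_def inner_add_left dot_cross_self)

lemma Mu_symbol_axis3: "Mu_symbol \<nu> lam B0 (axis 3 1) = 0"
  by (simp add: Mu_symbol_def)

text \<open>
  The second term of the symbol is orthogonal to \<open>e_hat 3\<close>, and the first contributes the factor
  \<open>(k $ 1)\<^sup>2 + (k $ 2)\<^sup>2\<close>, which is positive exactly off the vertical axis.
\<close>

lemma Mu_symbol_inner_axis3_pos: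
  assumes "\<nu> > 0" "k $ 1 \<noteq> 0 \<or> k $ 2 \<noteq> 0"
  shows "Mu_symbol \<nu> lam B0 k \<bullet> axis 3 1 > 0"
proof -
  have "k \<noteq> 0"
    using assms(2) by auto
  then have P: "\<nu> * norm k ^ 4 + (B0 \<bullet> k)\<^sup>2 > 0"
    using assms(1) by (intro add_pos_nonneg) auto
  then have D: "(norm k)\<^sup>2 * (Omega_hat lam \<bullet> k)\<^sup>2 + ((B0 \<bullet> k)\<^sup>2 + \<nu> * norm k ^ 4)\<^sup>2 > 0"
    by (intro add_nonneg_pos) (auto simp: add.commute)
  have "cross3 k (cross3 (axis 3 1) k) \<bullet> axis 3 1 = (k $ 1)\<^sup>2 + (k $ 2)\<^sup>2"
    by (simp add: cross3_simps axis_def power2_eq_square)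
  moreover have "cross3 (axis 3 1) k \<bullet> axis 3 1 = 0"
    by (simp add: dot_cross_self)
  moreover have "(k $ 1)\<^sup>2 + (k $ 2)\<^sup>2 > 0"
    using assms(2) by (simp add: sum_power2_gt_zero_iff)
  ultimately show ?thesis
    using P D by (simp add: Mu_symbol_def inner_add_left)
qed

text \<open>
  With \<open>p = \<nu> |k|\<^sup>4 + (B0 \<bullet> k)\<^sup>2\<close> and \<open>q = |k| |Omega_hat \<bullet> k|\<close>, the symbol has norm at most
  \<open>|k|\<^sup>2 (p + q) / (p\<^sup>2 + q\<^sup>2)\<close>, hence at most \<open>2 |k|\<^sup>2 / p \<le> 2 / (\<nu> |k|\<^sup>2)\<close>.
\<close>

lemma norm_Mu_symbol_le:
  assumes "\<nu> > 0" "norm k \<ge> 1"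
  shows "norm (Mu_symbol \<nu> lam B0 k) \<le> 2 / \<nu>"
proof -
  define r where "r = norm k"
  define p where "p = \<nu> * r ^ 4 + (B0 \<bullet> k)\<^sup>2"
  define q where "q = r * \<bar>Omega_hat lam \<bullet> k\<bar>"
  have r: "r \<ge> 1"
    using assms(2) by (simp add: r_def)
  have "\<nu> * r ^ 4 > 0"
    using assms(1) r by simp
  moreover have "p \<ge> \<nu> * r ^ 4"
    by (simp add: p_def)
  ultimately have p: "p > 0" "p \<ge> \<nu> * r ^ 4"
    by linarith+
  have q: "q \<ge> 0"
    using r by (simp add: q_def)
  have e: "norm (cross3 (axis 3 1) k) \<le> r"
    using norm_cross3_le[of "axis 3 1" k] by (simp add: r_def)
  have "norm (cross3 k (cross3 (axis 3 1) k)) \<le> r * norm (cross3 (axis 3 1) k)"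
    using norm_cross3_le by (simp add: r_def)
  also have "\<dots> \<le> r * r"
    using e r by (intro mult_left_mono) auto
  finally have ke: "norm (cross3 k (cross3 (axis 3 1) k)) \<le> r * r" .
  have D: "r\<^sup>2 * (Omega_hat lam \<bullet> k)\<^sup>2 + ((B0 \<bullet> k)\<^sup>2 + \<nu> * r ^ 4)\<^sup>2 = q\<^sup>2 + p\<^sup>2"
    by (simp add: p_def q_def power_mult_distrib add.commute)
  have "norm (Mu_symbol \<nu> lam B0 k)
      = norm (p *\<^sub>R cross3 k (cross3 (axis 3 1) k) + ((Omega_hat lam \<bullet> k) * r\<^sup>2) *\<^sub>R cross3 (axis 3 1) k) / (q\<^sup>2 + p\<^sup>2)"
    using D by (simp add: Mu_symbol_def p_def r_def)
  also have "\<dots> \<le> (p * (r * r) + (\<bar>Omega_hat lam \<bullet> k\<bar> * r\<^sup>2) * r) / (q\<^sup>2 + p\<^sup>2)"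
    using e ke p r
    by (intro divide_right_mono norm_triangle_le add_mono) (auto simp: abs_mult intro!: mult_mono)
  also have "\<dots> = r\<^sup>2 * (p + q) / (q\<^sup>2 + p\<^sup>2)"
    by (simp add: q_def power2_eq_square algebra_simps)
  also have "\<dots> \<le> r\<^sup>2 * (2 / p)"
  proof -
    have "q\<^sup>2 + p\<^sup>2 > 0"
      using p by (simp add: add_nonneg_pos)
    have "p * q \<le> q\<^sup>2 + p\<^sup>2"
      using sum_squares_bound[of p q] mult_nonneg_nonneg[of p q] p q by linarith
    then have "p * (p + q) \<le> 2 * (q\<^sup>2 + p\<^sup>2)"
      using zero_le_power2[of q] unfolding distrib_left power2_eq_square[symmetric] by linarith
    then have "(p + q) / (q\<^sup>2 + p\<^sup>2) \<le> 2 / p"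
      using p \<open>q\<^sup>2 + p\<^sup>2 > 0\<close> by (simp add: divide_simps mult.commute)
    then have "r\<^sup>2 * ((p + q) / (q\<^sup>2 + p\<^sup>2)) \<le> r\<^sup>2 * (2 / p)"
      by (rule mult_left_mono) simp
    then show ?thesis by simp
  qed
  also have "\<dots> \<le> 2 / \<nu>"
  proof -
    have "\<nu> * r\<^sup>2 \<le> \<nu> * r ^ 4"
      using assms(1) r by (intro mult_left_mono power_increasing) auto
    then have "r\<^sup>2 * \<nu> \<le> p"
      using p by (simp add: mult.commute)
    then show ?thesis
      using p assms(1) by (simp add: divide_simps)
  qed
  finally show ?thesis .
qed

section \<open>The bracket spaces and the lattice\<close>

lemma W_space_mono: "m \<le> n \<Longrightarrow> W_space \<nu> lam B0 \<alpha> m \<subseteq> W_space \<nu> lam B0 \<alpha> n"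
  by (rule lift_Suc_mono_le) (auto intro: fun_space.span_base)

lemma subspace_W_space: "fun_space.subspace (W_space \<nu> lam B0 \<alpha> n)"
  by (cases n) (simp_all add: W_zero_def)

definition off_axis :: "(real ^ 3) set" where
  "off_axis = {k \<in> int_lattice. k $ 1 \<noteq> 0 \<or> k $ 2 \<noteq> 0}"

lemma off_axisD:
  assumes "k \<in> off_axis"
  shows "k \<in> int_lattice" "k \<noteq> 0" "k $ 1 \<noteq> 0 \<or> k $ 2 \<noteq> 0" "norm k \<ge> 1"
proof -
  show "k \<in> int_lattice" "k \<noteq> 0" and *: "k $ 1 \<noteq> 0 \<or> k $ 2 \<noteq> 0"
    using assms by (auto simp: off_axis_def)
  then obtain i where "k $ i \<noteq> 0" by blast
  then have "\<bar>k $ i\<bar> \<ge> 1"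
    using assms by (intro Ints_nonzero_abs_ge1) (auto simp: off_axis_def int_lattice_def)
  then show "norm k \<ge> 1"
    using component_le_norm_cart[of k i] by linarith
qed

lemma finite_int_lattice_ball: "finite {k \<in> int_lattice. norm k \<le> N}"
proof (rule finite_subset)
  let ?F = "PiE (UNIV :: 3 set) (\<lambda>_. {- \<lceil>N\<rceil>..\<lceil>N\<rceil>})"
  show "finite ((\<lambda>f. (\<chi> i. of_int (f i)) :: real ^ 3) ` ?F)"
    by (intro finite_imageI finite_PiE) auto
  show "{k \<in> int_lattice. norm k \<le> N} \<subseteq> (\<lambda>f. \<chi> i. of_int (f i)) ` ?F"
  proof
    fix k assume "k \<in> {k \<in> int_lattice. norm k \<le> N}"
    then have int: "k $ i \<in> \<int>" and bound: "\<bar>k $ i\<bar> \<le> N" for i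
      using component_le_norm_cart[of k i] by (auto simp: int_lattice_def)
    have eq: "k = (\<chi> i. of_int \<lfloor>k $ i\<rfloor>)"
      using int by (simp add: vec_eq_iff)
    have bounds: "- \<lceil>N\<rceil> \<le> \<lfloor>k $ i\<rfloor>" "\<lfloor>k $ i\<rfloor> \<le> \<lceil>N\<rceil>" for i
      using bound[of i] by linarith+
    have "(\<lambda>i. \<lfloor>k $ i\<rfloor>) \<in> ?F"
      using bounds by auto
    with eq show "k \<in> (\<lambda>f. \<chi> i. of_int (f i)) ` ?F"
      by (rule image_eqI)
  qed
qed

section \<open>Propagation through the lattice\<close>

locale low_mode_forcing =
  fixes \<nu> lam :: real and B0 :: "real ^ 3" and \<alpha> :: "real ^ 3 \<Rightarrow> nat \<Rightarrow> real"
  assumes nu_pos: "\<nu> > 0"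
    and forced_modes: "\<And>k m. k \<in> {e_hat 1, e_hat 2, e_hat 3} \<Longrightarrow> m \<in> {0, 1} \<Longrightarrow> sigma_mode k m \<in> W_zero \<alpha>"
begin

abbreviation M where "M \<equiv> Mu_symbol \<nu> lam B0"

abbreviation W where "W \<equiv> W_space \<nu> lam B0 \<alpha>"

text \<open>
  The level at which a frequency appears is immaterial until the end, because the spaces increase.
  All amplitudes are required at once because isolating \<open>k + l\<close> takes brackets with both phases.
\<close>

definition reachable :: "real ^ 3 \<Rightarrow> bool" where
  "reachable k \<longleftrightarrow> (\<exists>n. \<forall>c. plane_wave c k \<in> W n)"

lemma reachable_uminus: "reachable (- k) \<longleftrightarrow> reachable k"
  unfolding reachable_def plane_wave_uminus by (metis complex_cnj_cnj)

lemma unit_wave_forced: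
  assumes "l = axis i 1 \<or> l = - axis i 1"
  shows "plane_wave c l \<in> W_zero \<alpha>"
proof -
  have "axis i 1 \<in> {e_hat 1, e_hat 2, e_hat 3}"
    using exhaust_3[of i] by auto
  then have "plane_wave c (axis i 1) \<in> W_zero \<alpha>" for c
    unfolding plane_wave_eq_modes using forced_modes subspace_W_space[of \<nu> lam B0 \<alpha> 0]
    by (intro fun_space.subspace_add fun_space.subspace_scale) auto
  then show ?thesis
    using assms by (auto simp: plane_wave_uminus)
qed

lemma reachable_unit: "reachable (axis i 1)"
  unfolding reachable_def using unit_wave_forced by (intro exI[of _ 0]) auto

text \<open>
  Once all waves at \<open>k\<close> are available, one more bracket with forced waves at \<open>l\<close> yields all waves at
  \<open>k + l\<close>, unless the interaction coefficient \<open>M k \<bullet> l + M l \<bullet> k\<close> degenerates.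
\<close>

lemma reachable_step:
  assumes k: "k \<in> int_lattice" "k \<noteq> 0" and r: "reachable k"
    and l: "l = axis i 1 \<or> l = - axis i 1"
    and nz: "M k \<bullet> l + M l \<bullet> k \<noteq> 0"
  shows "reachable (k + l)"
proof -
  let ?a = "M k \<bullet> l + M l \<bullet> k"
  obtain n where n: "plane_wave c k \<in> W n" for c
    using r unfolding reachable_def by blast
  have l': "l \<in> int_lattice" "l \<noteq> 0"
    using l by (auto simp: int_lattice_def axis_def vec_eq_iff)
  have "bracket \<nu> lam B0 (plane_wave c k) (plane_wave d l) \<in> W (Suc n)" for c d
    using n unit_wave_forced[OF l] by (auto intro!: fun_space.span_base)
  then have *: "fun_scale ?a (plane_wave (\<i> * c) (k + l)) \<in> W (Suc n)" for c
    unfolding bracket_plane_wave_sum[OF k l', symmetric]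
    by (intro fun_space.subspace_add subspace_W_space) auto
  have "plane_wave c (k + l) \<in> W (Suc n)" for c
  proof -
    \<comment> \<open>the factor \<open>- \<i>\<close> compensates the factor \<open>\<i>\<close> contributed by the gradient\<close>
    have "fun_scale (1 / ?a) (fun_scale ?a (plane_wave (\<i> * (- \<i> * c)) (k + l))) \<in> W (Suc n)"
      by (rule fun_space.subspace_scale [OF subspace_W_space *])
    moreover have "\<i> * (- \<i> * c) = c"
      by (simp add: mult.assoc[symmetric])
    ultimately show ?thesis
      using nz by (simp add: fun_scale_def)
  qed
  then show ?thesis
    unfolding reachable_def by blast
qed

text \<open>
  The symbol vanishes at \<open>e_hat 3\<close>, so the interaction coefficient with \<open>e_hat 3\<close> reduces to
  \<open>M k \<bullet> e_hat 3\<close>, which is nonzero off the vertical axis: every vertical line other than the axis is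
  reachable as soon as one of its points is.
\<close>

lemma reachable_vertical:
  assumes k: "k \<in> off_axis" and r: "reachable k"
  shows "reachable (k + of_int n *\<^sub>R axis 3 1)"
proof (induction n rule: int_induct[where k = 0])
  case base
  show ?case using r by simp
next
  case (step1 i)
  let ?k = "k + of_int i *\<^sub>R axis 3 1"
  have "?k \<in> off_axis"
    using k by (auto simp: off_axis_def int_lattice_def axis_def)
  note k' = off_axisD[OF this]
  have "M ?k \<bullet> axis 3 1 + M (axis 3 1) \<bullet> ?k \<noteq> 0"
    using Mu_symbol_inner_axis3_pos[OF nu_pos k'(3), of lam B0]
    by (simp add: Mu_symbol_uminus Mu_symbol_axis3)
  from reachable_step[OF k'(1,2) step1(2) _ this, of 3] have "reachable (?k + axis 3 1)"
    by simp
  then show ?case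
    by (simp add: algebra_simps)
next
  case (step2 i)
  let ?k = "k + of_int i *\<^sub>R axis 3 1"
  have "?k \<in> off_axis"
    using k by (auto simp: off_axis_def int_lattice_def axis_def)
  note k' = off_axisD[OF this]
  have "M ?k \<bullet> - axis 3 1 + M (- axis 3 1) \<bullet> ?k \<noteq> 0"
    using Mu_symbol_inner_axis3_pos[OF nu_pos k'(3), of lam B0]
    by (simp add: Mu_symbol_uminus Mu_symbol_axis3)
  from reachable_step[OF k'(1,2) step2(2) _ this, of 3] have "reachable (?k + - axis 3 1)"
    by simp
  then show ?case
    by (simp add: algebra_simps)
qed

text \<open>
  The direct step from \<open>k\<close> may be degenerate. Climbing the vertical line through \<open>k\<close> avoids this:
  at height \<open>n\<close> the term \<open>M k \<bullet> l\<close> stays bounded, whereas \<open>M l \<bullet> k\<close> grows linearly in \<open>n\<close> because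
  \<open>M l \<bullet> e_hat 3 > 0\<close>. The horizontal step is taken at a large height, followed by the descent along
  the vertical line through \<open>k + l\<close>.
\<close>

lemma reachable_horizontal:
  assumes k: "k \<in> off_axis" and r: "reachable k"
    and l: "l = axis i 1 \<or> l = - axis i 1" "i \<noteq> 3"
    and kl: "k + l \<in> off_axis"
  shows "reachable (k + l)"
proof -
  have "l $ 1 \<noteq> 0 \<or> l $ 2 \<noteq> 0"
    using l exhaust_3[of i] by (auto simp: axis_def)
  then have "M l \<bullet> axis 3 1 > 0"
    by (rule Mu_symbol_inner_axis3_pos[OF nu_pos])
  \<comment> \<open>a height whose contribution to \<open>M l \<bullet> k\<close> outweighs the value at height \<open>0\<close> and the bound \<open>2 / \<nu>\<close>\<close>
  then obtain n :: nat where n: "2 / \<nu> + \<bar>M l \<bullet> k\<bar> < n * (M l \<bullet> axis 3 1)"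
    using reals_Archimedean3 by blast
  let ?k = "k + of_int (int n) *\<^sub>R axis 3 1"
  have k': "?k \<in> off_axis"
    using k by (auto simp: off_axis_def int_lattice_def axis_def)
  have "\<bar>M ?k \<bullet> l\<bar> \<le> norm (M ?k) * norm l"
    by (rule Cauchy_Schwarz_ineq2)
  also have "\<dots> \<le> 2 / \<nu>"
    using norm_Mu_symbol_le[OF nu_pos off_axisD(4)[OF k']] l by auto
  finally have "M ?k \<bullet> l + M l \<bullet> ?k \<noteq> 0"
    using n by (simp add: inner_add_right)
  then have "reachable (?k + l)"
    by (rule reachable_step[OF off_axisD(1,2)[OF k'] reachable_vertical[OF k r] l(1)])
  then have "reachable ((k + l) + of_int (int n) *\<^sub>R axis 3 1)"
    by (simp add: algebra_simps)
  moreover have "(k + l) + of_int (int n) *\<^sub>R axis 3 1 \<in> off_axis"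
    using kl by (auto simp: off_axis_def int_lattice_def axis_def)
  ultimately have "reachable ((k + l) + of_int (int n) *\<^sub>R axis 3 1 + of_int (- int n) *\<^sub>R axis 3 1)"
    by (rule reachable_vertical[rotated])
  then show ?thesis
    by simp
qed

definition horizontal_point :: "int \<Rightarrow> int \<Rightarrow> real ^ 3" where
  "horizontal_point a b = of_int a *\<^sub>R axis 1 1 + of_int b *\<^sub>R axis 2 1"

lemma horizontal_point_off_axis: "a \<noteq> 0 \<or> b \<noteq> 0 \<Longrightarrow> horizontal_point a b \<in> off_axis"
  by (auto simp: horizontal_point_def off_axis_def int_lattice_def axis_def)

text \<open>
  The origin of the horizontal plane has to be avoided, since vertical moves are not available above
  it. The half plane \<open>a \<ge> 1\<close> contains the forced vector \<open>e_hat 1\<close> and is connected under unit steps;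
  the line \<open>a = 0\<close> is entered from it, and the half plane \<open>a \<le> - 1\<close> is its mirror image.
\<close>

lemma reachable_horizontal_point:
  assumes "a \<noteq> 0 \<or> b \<noteq> 0"
  shows "reachable (horizontal_point a b)"
proof -
  have move: "reachable (horizontal_point a' b')"
    if "reachable (horizontal_point a b)" "a \<noteq> 0 \<or> b \<noteq> 0" "a' \<noteq> 0 \<or> b' \<noteq> 0"
      "horizontal_point a' b' - horizontal_point a b = l" "l = axis i 1 \<or> l = - axis i 1" "i \<noteq> 3"
    for a b a' b' l i
    using reachable_horizontal[OF horizontal_point_off_axis[OF that(2)] that(1) that(5,6)]
      horizontal_point_off_axis[OF that(3)] that(4) by auto
  have right: "reachable (horizontal_point a b)" if "a \<ge> 1" for a b
  proof -
    have a0: "reachable (horizontal_point a 0)"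
      using that
    proof (induction a rule: int_ge_induct)
      case base
      show ?case using reachable_unit[of 1] by (simp add: horizontal_point_def)
    next
      case (step i)
      show ?case
        by (rule move[OF step(2), of _ _ "axis 1 1" 1]) (use step in \<open>auto simp: horizontal_point_def algebra_simps\<close>)
    qed
    show ?thesis
    proof (induction b rule: int_induct[where k = 0])
      case base
      show ?case by (rule a0)
    next
      case (step1 i)
      show ?case
        by (rule move[OF step1(2), of _ _ "axis 2 1" 2]) (use that in \<open>auto simp: horizontal_point_def algebra_simps\<close>)
    next
      case (step2 i)
      show ?case
        by (rule move[OF step2(2), of _ _ "- axis 2 1" 2]) (use that in \<open>auto simp: horizontal_point_def algebra_simps\<close>)
    qed
  qed
  consider "a \<ge> 1" | "a \<le> - 1" | "a = 0" "b \<noteq> 0"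
    using assms by linarith
  then show ?thesis
  proof cases
    case 1
    then show ?thesis by (rule right)
  next
    case 2
    then have "reachable (horizontal_point (- a) (- b))"
      by (intro right) simp
    then have "reachable (- horizontal_point a b)"
      by (simp add: horizontal_point_def)
    then show ?thesis
      by (simp add: reachable_uminus)
  next
    case 3
    then show ?thesis
      by (intro move[OF right[of 1 b], of _ _ "- axis 1 1" 1]) (auto simp: horizontal_point_def)
  qed
qed

text \<open>
  The axis is entered from \<open>k = e_hat 1 + n e_hat 3\<close> by the step \<open>- e_hat 1\<close>. Because \<open>M k \<bullet> k = 0\<close>
  and \<open>M (e_hat 1) \<bullet> e_hat 1 = 0\<close>, both \<open>- M k \<bullet> e_hat 1\<close> and \<open>M (e_hat 1) \<bullet> k\<close> are \<open>n\<close> times a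
  positive vertical component, so that they cannot cancel at any height \<open>n \<noteq> 0\<close>.
\<close>

lemma reachable_axis:
  assumes "n \<noteq> 0"
  shows "reachable (of_int n *\<^sub>R axis 3 1)"
proof -
  let ?k = "axis 1 1 + of_int n *\<^sub>R axis 3 1 :: real ^ 3"
  have e: "axis 1 1 \<in> off_axis" and k: "?k \<in> off_axis"
    by (auto simp: off_axis_def int_lattice_def axis_def)
  have "M ?k \<bullet> ?k = 0" "M (axis 1 1) \<bullet> axis 1 1 = 0"
    by (rule Mu_symbol_inner_self)+
  then have "M ?k \<bullet> (- axis 1 1) + M (- axis 1 1) \<bullet> ?k
      = of_int n * (M ?k \<bullet> axis 3 1 + M (axis 1 1) \<bullet> axis 3 1)"
    by (simp add: inner_add_right Mu_symbol_uminus algebra_simps)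
  moreover have "M ?k \<bullet> axis 3 1 > 0" "M (axis 1 1) \<bullet> axis 3 1 > 0"
    by (intro Mu_symbol_inner_axis3_pos nu_pos off_axisD(3) e k)+
  ultimately have "M ?k \<bullet> (- axis 1 1) + M (- axis 1 1) \<bullet> ?k \<noteq> 0"
    using assms by simp
  then have "reachable (?k + - axis 1 1)"
    using reachable_step[OF off_axisD(1,2)[OF k] reachable_vertical[OF e reachable_unit], of _ 1] by blast
  then show ?thesis by simp
qed

lemma reachable_all:
  assumes "k \<in> int_lattice" "k \<noteq> 0"
  shows "reachable k"
proof -
  define a b c where "a = \<lfloor>k $ 1\<rfloor>" and "b = \<lfloor>k $ 2\<rfloor>" and "c = \<lfloor>k $ 3\<rfloor>"
  have "of_int a = k $ 1" "of_int b = k $ 2" "of_int c = k $ 3"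
    using assms(1) by (auto simp: a_def b_def c_def int_lattice_def)
  then have k: "k = horizontal_point a b + of_int c *\<^sub>R axis 3 1"
    by (simp add: vec_eq_iff forall_3 horizontal_point_def axis_def)
  show ?thesis
  proof (cases "a \<noteq> 0 \<or> b \<noteq> 0")
    case True
    then show ?thesis
      unfolding k by (intro reachable_vertical horizontal_point_off_axis reachable_horizontal_point)
  next
    case False
    then have "k = of_int c *\<^sub>R axis 3 1"
      using k by (simp add: horizontal_point_def)
    moreover from this have "c \<noteq> 0"
      using assms(2) by auto
    ultimately show ?thesis
      using reachable_axis by simp
  qed
qed

text \<open>
  Only finitely many wave vectors lie in the ball, and the spaces \<open>W n\<close> increase, so the largest of
  the levels needed for the individual wave vectors serves all of them.
\<close>

lemma H_space_subset_W: "\<exists>n. H_space N \<subseteq> W n"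
proof -
  let ?F = "{k \<in> int_lattice. norm k \<le> N} - {0}"
  have "\<forall>k\<in>?F. \<exists>n. \<forall>c. plane_wave c k \<in> W n"
    using reachable_all unfolding reachable_def by blast
  from bchoice[OF this] obtain f where f: "\<forall>k\<in>?F. \<forall>c. plane_wave c k \<in> W (f k)" ..
  have "finite (f ` ?F)"
    by (intro finite_imageI finite_Diff finite_int_lattice_ball)
  then have "f k \<le> Max (f ` ?F)" if "k \<in> ?F" for k
    by (rule Max_ge) (rule imageI[OF that])
  then have "plane_wave c k \<in> W (Max (f ` ?F))" if "k \<in> ?F" for k c
    using f that W_space_mono by blast
  then have "H_space N \<subseteq> W (Max (f ` ?F))"
    unfolding H_space_def
    by (intro fun_space.span_minimal subspace_W_space)
      (auto simp: sigma_mode_eq_plane_wave int_lattice_plus_def)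
  then show ?thesis ..
qed

end

theorem theorem4p3:
  fixes \<nu> lam :: real and B0 :: "real ^ 3" and \<alpha> :: "real ^ 3 \<Rightarrow> nat \<Rightarrow> real"
  assumes "\<nu> > 0" and "norm B0 = 1"
    and "\<And>k m. k \<in> {e_hat 1, e_hat 2, e_hat 3} \<Longrightarrow> m \<in> {0, 1} \<Longrightarrow> sigma_mode k m \<in> W_zero \<alpha>"
  shows "\<forall>N > (0::real). \<exists>n. H_space N \<subseteq> W_space \<nu> lam B0 \<alpha> n"
proof -
  interpret low_mode_forcing \<nu> lam B0 \<alpha>
    using assms by unfold_locales
  show ?thesis
    using H_space_subset_W by blast
qed

end
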